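(* If $\alpha>1$ and $\theta\in(0,\pi)$, then $$L_\alpha(\theta)=\csc^2\theta\,\big[(2\alpha-1)\cos\theta\,L_{\alpha-1}(\theta)+(\alpha-1)^2L_{\alpha-2}(\theta)\big].$$
   Context: For $\alpha>-1$ and $\theta\in(0,\pi)$, $L_\alpha(\theta)=\int_0^\infty\mathcal K_0(x)\,e^{x\cos\theta}\,x^\alpha\,dx$, where $\mathcal K_0(z)=\int_1^\infty e^{-zx}(x^2-1)^{-1/2}\,dx$ for $z>0$ is the zeroth modified Bessel function of the second kind. *)

theory Defs
  imports "HOL-Analysis.Analysis"
begin

text \<open>
  The improper integrals are taken as Lebesgue integrals over open half-lines. Both
  integrands are positive, so this is the usual reading of the integrals; they converge
  for \<open>z > 0\<close>, respectively for \<open>\<alpha> > -1\<close> and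
  \<open>\<theta> \<in> {0<..<pi}\<close>. Outside these ranges the definitions carry no meaning.
\<close>

definition bessel_K0 :: "real \<Rightarrow> real" where
  "bessel_K0 z = (LBINT x:{1<..}. exp (- z * x) * (x\<^sup>2 - 1) powr (- 1 / 2))"

definition L :: "real \<Rightarrow> real \<Rightarrow> real" where
  "L \<alpha> \<theta> = (LBINT x:{0<..}. bessel_K0 x * exp (x * cos \<theta>) * x powr \<alpha>)"

end

theory Submission
  imports Defs "HOL-Real_Asymp.Real_Asymp"
begin

text \<open>
  Integrating first over \<open>x\<close> (Tonelli) turns \<open>L \<alpha> \<theta>\<close> into \<open>Gamma (\<alpha> + 1) * J (\<alpha> + 1)\<close>, where
  \<open>J \<beta>\<close> is the integral of \<open>(t\<^sup>2 - 1) powr (-1/2) * (t - c) powr (-\<beta>)\<close> over \<open>t > 1\<close> and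
  \<open>c = cos \<theta>\<close>. The recurrence then expresses that the derivative of
  \<open>sqrt (t\<^sup>2 - 1) * (t - c) powr (-\<alpha>)\<close>, which vanishes at both ends of \<open>{1<..}\<close>, integrates to zero:
  expanding \<open>t (t - c) - \<alpha> (t\<^sup>2 - 1)\<close> in powers of \<open>t - c\<close> gives the three integrals
  \<open>J (\<alpha> - 1)\<close>, \<open>J \<alpha>\<close> and \<open>J (\<alpha> + 1)\<close>.
\<close>

definition J :: "real \<Rightarrow> real \<Rightarrow> real" where
  "J c \<beta> = (LBINT t:{1<..}. (t\<^sup>2 - 1) powr (- 1 / 2) * (t - c) powr (- \<beta>))"

text \<open>Euler's integral for \<open>Gamma (a + 1)\<close>, rescaled by
  \<open>x -> p * x\<close>. It evaluates the inner integral once the order of integration in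
  \<open>L\<close> is swapped.\<close>

lemma has_bochner_integral_exp_powr:
  fixes a p :: real
  assumes a: "a > -1" and p: "p > 0"
  shows "has_bochner_integral lborel (\<lambda>x. indicator {0<..} x * (exp (- p * x) * x powr a))
           (Gamma (a + 1) * p powr (- (a + 1)))"
proof -
  let ?g = "\<lambda>x::real. indicator {0<..} x * (exp (- x) * x powr a)"
  have "(\<integral>\<^sup>+ x. ennreal (?g x) \<partial>lborel)
      = (\<integral>\<^sup>+ x. ennreal (indicator {0..} x * x powr (a + 1 - 1) / exp x) \<partial>lborel)"
    by (intro nn_integral_cong) (auto simp: indicator_def exp_minus field_simps)
  also have "\<dots> = ennreal (Gamma (a + 1))"
    using Gamma_conv_nn_integral_real[of "a + 1"] a by simp
  finally have "has_bochner_integral lborel ?g (Gamma (a + 1))"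
    using a by (intro has_bochner_integral_nn_integral) auto
  then have "has_bochner_integral lborel (\<lambda>x. ?g (0 + p * x)) (Gamma (a + 1) /\<^sub>R \<bar>p\<bar>)"
    by (subst (asm) lborel_has_bochner_integral_real_affine_iff[of p _ _ 0]) (use p in auto)
  \<comment> \<open>The factor \<open>p powr (- a)\<close> cancels the \<open>p powr a\<close>
    contained in \<open>(p * x) powr a\<close>.\<close>
  then have "has_bochner_integral lborel (\<lambda>x. ?g (0 + p * x) * p powr (- a))
      (Gamma (a + 1) /\<^sub>R \<bar>p\<bar> * p powr (- a))"
    by (rule has_bochner_integral_mult_left)
  also have "(\<lambda>x. ?g (0 + p * x) * p powr (- a))
      = (\<lambda>x. indicator {0<..} x * (exp (- p * x) * x powr a))"
    using p by (auto simp: fun_eq_iff indicator_def powr_mult powr_minus zero_less_mult_iff)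
  also have "Gamma (a + 1) /\<^sub>R \<bar>p\<bar> * p powr (- a) = Gamma (a + 1) * p powr (- (a + 1))"
    using p powr_add[of p "- a" "- 1"] by (simp add: powr_minus_divide divide_inverse)
  finally show ?thesis .
qed

text \<open>Comparison with a function that has an explicit bounded antiderivative:
  \<open>sqrt (1 - t powr (- b))\<close> increases from 0 to 1 on \<open>{1<..}\<close>, and its
  derivative has the same singularity at 1 and the same decay at infinity, up to constants.\<close>

lemma set_integrable_J_base:
  fixes b :: real
  assumes b: "0 < b" "b \<le> 2"
  shows "set_integrable lborel {1<..} (\<lambda>t. (t\<^sup>2 - 1) powr (- 1 / 2) * t powr (- b))"
proof -
  let ?F = "\<lambda>t::real. (1 - t powr (- b)) powr (1/2)"
  let ?f = "\<lambda>t::real. 1/2 * (1 - t powr (- b)) powr (- 1/2) * (b * t powr (- b - 1))"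
  have pos: "1 - t powr (- b) > 0" if "t > 1" for t
    using powr_less_mono[of "- b" 0 t] that b by simp
  have "set_integrable lborel (einterval (ereal 1) \<infinity>) ?f"
  proof (rule interval_integral_FTC_nonneg(1)[where F = ?F and A = 0 and B = 1])
    fix t assume "ereal 1 < ereal t"
    then have t: "t > 1" by simp
    show "DERIV ?F t :> ?f t"
      using t pos[OF t] by (auto intro!: derivative_eq_intros)
    show "isCont ?f t"
      using t pos[OF t] by (auto intro!: continuous_intros)
  next
    show "AE x in lborel. ereal 1 < ereal x \<longrightarrow> ereal x < \<infinity> \<longrightarrow> 0 \<le> ?f x"
      using b by auto
    \<comment> \<open>The base tends to 0, so the limit relies on the base being nonnegative and the
      exponent positive.\<close>
    have "(?F \<longlongrightarrow> (1 - 1 powr (- b)) powr (1/2)) (at_right 1)"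
    proof (rule tendsto_powr2)
      show "((\<lambda>t. 1 - t powr - b) \<longlongrightarrow> 1 - 1 powr - b) (at_right 1)"
        by (intro tendsto_intros) auto
      show "\<forall>\<^sub>F x in at_right 1. 0 \<le> 1 - x powr - b"
        using eventually_at_right_less[of "1::real"] by eventually_elim (use pos in force)
    qed auto
    then show "((?F \<circ> real_of_ereal) \<longlongrightarrow> 0) (at_right (ereal 1))"
      by (simp add: ereal_tendsto_simps)
    have "(?F \<longlongrightarrow> (1 - 0) powr (1/2)) at_top"
      by (intro tendsto_intros tendsto_neg_powr filterlim_ident) (use b in auto)
    then show "((?F \<circ> real_of_ereal) \<longlongrightarrow> 1) (at_left \<infinity>)"
      by (simp add: ereal_tendsto_simps)
  qed simp
  then have "set_integrable lborel {1<..} (\<lambda>t. 2 / b * ?f t)"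
    by (intro set_integrable_mult_right) simp
  then show ?thesis
  proof (rule set_integrable_bound)
    show "AE t in lborel. t \<in> {1<..} \<longrightarrow>
        norm ((t\<^sup>2 - 1) powr (- 1 / 2) * t powr (- b)) \<le> norm (2 / b * ?f t)"
    proof (intro AE_I2 impI)
      fix t :: real assume "t \<in> {1<..}"
      then have t: "t > 1" by simp
      \<comment> \<open>This is where \<open>b \<le> 2\<close> enters; the exponent -1/2 then
        reverses the inequality.\<close>
      have "1 - t powr (- b) \<le> 1 - t powr (- 2)"
        using t b by (simp add: powr_mono)
      also have "\<dots> = (t\<^sup>2 - 1) * t powr (- 2)"
        using t by (simp add: powr_minus powr_numeral field_simps)
      finally have "((t\<^sup>2 - 1) * t powr (- 2)) powr (- 1/2) \<le> (1 - t powr (- b)) powr (- 1/2)"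
        using pos[OF t] by (intro powr_mono2') auto
      also have "((t\<^sup>2 - 1) * t powr (- 2)) powr (- 1/2) = (t\<^sup>2 - 1) powr (- 1/2) * t"
        using t by (simp add: powr_mult powr_powr)
      finally have "(t\<^sup>2 - 1) powr (- 1/2) * t * t powr (- b - 1)
          \<le> (1 - t powr (- b)) powr (- 1/2) * t powr (- b - 1)"
        by (rule mult_right_mono) simp
      moreover have "t * t powr (- b - 1) = t powr (- b)"
        using t by (simp add: powr_diff)
      ultimately show "norm ((t\<^sup>2 - 1) powr (- 1 / 2) * t powr (- b)) \<le> norm (2 / b * ?f t)"
        using b by (simp add: abs_mult mult.assoc)
    qed
  qed (simp add: set_borel_measurable_def)
qed

text \<open>Reduction to the case \<open>c = 0\<close>: \<open>t - c\<close> is at least a positive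
  multiple of \<open>t\<close>, and since \<open>t > 1\<close> the exponent may be capped at
  2.\<close>

lemma set_integrable_J:
  fixes c b :: real
  assumes c: "c < 1" and b: "b > 0"
  shows "set_integrable lborel {1<..} (\<lambda>t. (t\<^sup>2 - 1) powr (- 1 / 2) * (t - c) powr (- b))"
proof -
  \<comment> \<open>For \<open>t > 1\<close>: \<open>t - c \<ge> (1 - c) * t\<close> if
    \<open>c \<ge> 0\<close>, and \<open>t - c \<ge> t\<close> if \<open>c < 0\<close>.\<close>
  define m where "m = min 1 (1 - c)"
  have m: "m > 0" using c by (simp add: m_def)
  have "set_integrable lborel {1<..}
      (\<lambda>t. m powr (- b) * ((t\<^sup>2 - 1) powr (- 1 / 2) * t powr (- min b 2)))"
    using b by (intro set_integrable_mult_right set_integrable_J_base) auto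
  then show ?thesis
  proof (rule set_integrable_bound)
    show "AE t in lborel. t \<in> {1<..} \<longrightarrow>
        norm ((t\<^sup>2 - 1) powr (- 1 / 2) * (t - c) powr (- b))
        \<le> norm (m powr (- b) * ((t\<^sup>2 - 1) powr (- 1 / 2) * t powr (- min b 2)))"
    proof (intro AE_I2 impI)
      fix t :: real assume "t \<in> {1<..}"
      then have t: "t > 1" by simp
      have "m * t \<le> t - c"
      proof (cases "c \<ge> 0")
        case True
        then have "c * 1 \<le> c * t" using t by (intro mult_left_mono) auto
        with True show ?thesis by (simp add: m_def min_def algebra_simps)
      qed (simp add: m_def)
      then have "(t - c) powr (- b) \<le> (m * t) powr (- b)"
        using m t b by (intro powr_mono2') auto
      also have "\<dots> = m powr (- b) * t powr (- b)"
        using m t by (simp add: powr_mult)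
      also have "\<dots> \<le> m powr (- b) * t powr (- min b 2)"
        using t by (intro mult_left_mono powr_mono) auto
      finally have "(t\<^sup>2 - 1) powr (- 1 / 2) * (t - c) powr (- b)
          \<le> (t\<^sup>2 - 1) powr (- 1 / 2) * (m powr (- b) * t powr (- min b 2))"
        by (rule mult_left_mono) simp
      then show "norm ((t\<^sup>2 - 1) powr (- 1 / 2) * (t - c) powr (- b))
          \<le> norm (m powr (- b) * ((t\<^sup>2 - 1) powr (- 1 / 2) * t powr (- min b 2)))"
        by (simp add: abs_mult mult.left_commute)
    qed
  qed (simp add: set_borel_measurable_def)
qed

text \<open>The exponentials combine to \<open>exp (- (t - c) * x)\<close>, so the
  \<open>x\<close>-integral is a Gamma integral with parameter \<open>t - c\<close>, positive
  because \<open>t > 1 > c\<close>.\<close>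

lemma L_eq_Gamma_J:
  assumes a: "a > -1" and \<theta>: "cos \<theta> < 1"
  shows "L a \<theta> = Gamma (a + 1) * J (cos \<theta>) (a + 1)"
proof -
  define c where "c = cos \<theta>"
  define w where "w t = indicator {1<..} t * (t\<^sup>2 - 1) powr (- 1 / 2)" for t :: real
  define e where "e t x = indicator {0<..} x * (exp (- (t - c) * x) * x powr a)" for t x :: real
  have w_meas [measurable]: "w \<in> borel_measurable borel"
    unfolding w_def by measurable
  \<comment> \<open>The indicator inside \<open>w\<close> makes both sides vanish for
    \<open>t \<le> 1\<close>, so the formula holds for every \<open>t\<close>.\<close>
  have inner: "has_bochner_integral lborel (\<lambda>x. w t * e t x)
      (w t * (Gamma (a + 1) * (t - c) powr (- (a + 1))))" for t
  proof (cases "t > 1")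
    case True
    then show ?thesis unfolding e_def
      using has_bochner_integral_exp_powr[of a "t - c"] a \<theta>
      by (intro has_bochner_integral_mult_right) (auto simp: c_def)
  qed (simp add: w_def has_bochner_integral_zero)
  have nonneg: "0 \<le> w t * e t x" for t x
    by (simp add: w_def e_def)
  have outer: "integrable lborel (\<lambda>t. w t * (Gamma (a + 1) * (t - c) powr (- (a + 1))))"
    using set_integrable_mult_right[OF set_integrable_J[of c "a + 1"], of "Gamma (a + 1)"] a \<theta>
    by (simp add: set_integrable_def c_def w_def mult_ac)
  \<comment> \<open>The integrand is nonnegative, so the iterated integral of its norm is the one
    just evaluated, and \<open>outer\<close> bounds it.\<close>
  have int: "integrable (lborel \<Otimes>\<^sub>M lborel) (\<lambda>(t, x). w t * e t x)"
  proof (rule lborel_pair.Fubini_integrable)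
    show "(\<lambda>(t, x). w t * e t x) \<in> borel_measurable (lborel \<Otimes>\<^sub>M lborel)"
      unfolding e_def by measurable
    show "integrable lborel (\<lambda>t. LINT x|lborel. norm (case (t, x) of (t, x) \<Rightarrow> w t * e t x))"
      using outer by (simp only: prod.case real_norm_def abs_of_nonneg[OF nonneg]
        inner[THEN has_bochner_integral_integral_eq])
    show "AE t in lborel. integrable lborel (\<lambda>x. case (t, x) of (t, x) \<Rightarrow> w t * e t x)"
      using inner by (auto simp: has_bochner_integral_iff)
  qed
  have "L a \<theta> = (LINT x|lborel. LINT t|lborel. w t * e t x)"
    unfolding L_def bessel_K0_def set_lebesgue_integral_def c_def[symmetric]
  proof (intro Bochner_Integration.integral_cong refl)
    fix x :: real
    have "(LINT t|lborel. w t * e t x) = (LINT t|lborel. (indicator {1<..} t *\<^sub>R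
        (exp (- x * t) * (t\<^sup>2 - 1) powr (- 1 / 2))) * (indicator {0<..} x * exp (x * c) * x powr a))"
      by (intro Bochner_Integration.integral_cong refl)
        (simp add: w_def e_def left_diff_distrib exp_diff exp_minus field_simps)
    also have "\<dots> = (LINT t|lborel. indicator {1<..} t *\<^sub>R
        (exp (- x * t) * (t\<^sup>2 - 1) powr (- 1 / 2))) * (indicator {0<..} x * exp (x * c) * x powr a)"
      \<comment> \<open>This rule has no integrability premise, so it also covers
        \<open>x \<le> 0\<close>, where the Bessel integral diverges and the indicator is 0.\<close>
      by (rule integral_mult_left_zero)
    finally show "indicator {0<..} x *\<^sub>R ((LINT t|lborel. indicator {1<..} t *\<^sub>R
        (exp (- x * t) * (t\<^sup>2 - 1) powr (- 1 / 2))) * exp (x * c) * x powr a)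
        = (LINT t|lborel. w t * e t x)"
      by (simp add: mult_ac)
  qed
  also have "\<dots> = (LINT t|lborel. LINT x|lborel. w t * e t x)"
    by (rule lborel_pair.Fubini_integral[OF int])
  also have "\<dots> = (LINT t|lborel. Gamma (a + 1) * (w t * (t - c) powr (- (a + 1))))"
    by (simp only: inner[THEN has_bochner_integral_integral_eq] mult_ac)
  also have "\<dots> = Gamma (a + 1) * J c (a + 1)"
    by (simp add: J_def set_lebesgue_integral_def w_def mult_ac)
  finally show ?thesis by (simp add: c_def)
qed

lemma J_recurrence:
  fixes c a :: real
  assumes c: "c < 1" and a: "a > 1"
  shows "a * (1 - c\<^sup>2) * J c (a + 1) = (2 * a - 1) * c * J c a + (a - 1) * J c (a - 1)"
proof -
  let ?F = "\<lambda>t. (t\<^sup>2 - 1) powr (1/2) * (t - c) powr (- a)"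
  let ?j = "\<lambda>b t. (t\<^sup>2 - 1) powr (- 1 / 2) * (t - c) powr (- b)"
  let ?f = "\<lambda>t. a * (1 - c\<^sup>2) * ?j (a + 1) t - (2 * a - 1) * c * ?j a t - (a - 1) * ?j (a - 1) t"
  note int = set_integrable_J[OF c]
  have sq: "t\<^sup>2 - 1 > 0" if "t > 1" for t :: real
    using that by simp
  have f_int: "set_integrable lborel {1<..} ?f"
    using a by (intro set_integral_diff set_integrable_mult_right int) auto
  have "(LBINT t=ereal 1..\<infinity>. ?f t) = 0 - 0"
  proof (rule interval_integral_FTC_integrable[where F = ?F])
    fix t assume "ereal 1 < ereal t"
    then have t: "t > 1" by simp
    have tc: "t - c > 0" using t c by simp
    define u where "u = t - c"
    have u: "u > 0" "t = u + c" using tc by (auto simp: u_def)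
    \<comment> \<open>With \<open>y\<close> and \<open>z\<close> as the lowest powers, every other
      power is a polynomial multiple of them, and the derivative formula becomes a polynomial
      identity.\<close>
    define y where "y = (t\<^sup>2 - 1) powr (- 1 / 2)"
    define z where "z = u powr (- a - 1)"
    have y2: "(t\<^sup>2 - 1) powr (1/2) = (t\<^sup>2 - 1) * y"
      using sq[OF t] powr_add[of "t\<^sup>2 - 1" 1 "- 1 / 2"] by (simp add: y_def)
    have z: "u powr (- a) = u * z" "u powr (- (a - 1)) = u\<^sup>2 * z" "u powr (- (a + 1)) = z"
      using u powr_add[of u 1 "- a - 1"] powr_add[of u 2 "- a - 1"]
      by (simp_all add: z_def powr_numeral)
    have "(?F has_real_derivative
        t * y * u powr (- a) + (t\<^sup>2 - 1) powr (1/2) * (- a * z)) (at t)"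
      using sq[OF t] tc
      by (auto intro!: derivative_eq_intros simp: y_def z_def u_def)
    also have "t * y * u powr (- a) + (t\<^sup>2 - 1) powr (1/2) * (- a * z) = ?f t"
      unfolding y2 u_def[symmetric] y_def[symmetric] z unfolding u(2)
      by algebra
    finally show "(?F has_vector_derivative ?f t) (at t)"
      by (simp add: has_real_derivative_iff_has_vector_derivative)
    show "isCont ?f t"
      using sq[OF t] tc by (intro continuous_intros) auto
  next
    show "set_integrable lborel (einterval (ereal 1) \<infinity>) ?f"
      using f_int by simp
    have "((\<lambda>t::real. (t\<^sup>2 - 1) powr (1/2)) \<longlongrightarrow> (1\<^sup>2 - 1) powr (1/2)) (at_right 1)"
    proof (rule tendsto_powr2)
      show "((\<lambda>t::real. t\<^sup>2 - 1) \<longlongrightarrow> 1\<^sup>2 - 1) (at_right 1)"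
        by (intro tendsto_intros)
      show "\<forall>\<^sub>F t in at_right 1. 0 \<le> t\<^sup>2 - (1::real)"
        using eventually_at_right_less[of "1::real"] by eventually_elim simp
    qed auto
    moreover have "((\<lambda>t. (t - c) powr (- a)) \<longlongrightarrow> (1 - c) powr (- a)) (at_right 1)"
      using c by (intro tendsto_intros) auto
    ultimately have "(?F \<longlongrightarrow> (1\<^sup>2 - 1) powr (1/2) * (1 - c) powr (- a)) (at_right 1)"
      by (rule tendsto_mult)
    then show "((?F \<circ> real_of_ereal) \<longlongrightarrow> 0) (at_right (ereal 1))"
      by (simp add: ereal_tendsto_simps)
    \<comment> \<open>The function behaves like \<open>t powr (1 - a)\<close>, hence the need for
      \<open>a > 1\<close>.\<close>
    have "(?F \<longlongrightarrow> 0) at_top"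
      using a by real_asymp
    then show "((?F \<circ> real_of_ereal) \<longlongrightarrow> 0) (at_left \<infinity>)"
      by (simp add: ereal_tendsto_simps)
  qed simp
  then have "0 = (LBINT t:{1<..}. ?f t)"
    by (simp add: interval_integral_to_infinity_eq)
  also have "\<dots> = a * (1 - c\<^sup>2) * J c (a + 1) - (2 * a - 1) * c * J c a - (a - 1) * J c (a - 1)"
    unfolding J_def using a by (simp only: set_integral_diff
        set_integral_mult_right set_integrable_mult_right int)
  finally show ?thesis by simp
qed

theorem lemmaC32:
  fixes \<alpha> \<theta> :: real
  assumes "\<alpha> > 1" and "\<theta> \<in> {0<..<pi}"
  shows "L \<alpha> \<theta> =
    (1 / sin \<theta>)\<^sup>2 *
      ((2 * \<alpha> - 1) * cos \<theta> * L (\<alpha> - 1) \<theta> + (\<alpha> - 1)\<^sup>2 * L (\<alpha> - 2) \<theta>)"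
proof -
  have pos_not_nonpos_Int: "x \<notin> \<int>\<^sub>\<le>\<^sub>0" if "x > 0" for x :: real
    using that by (auto elim!: nonpos_Ints_cases)
  have s: "sin \<theta> > 0" using assms by (intro sin_gt_zero) auto
  have c: "cos \<theta> < 1"
    using cos_monotone_0_pi[of 0 \<theta>] assms by simp
  define c where "c = cos \<theta>"
  \<comment> \<open>The smallest of the three Gamma values; its argument is positive, and the other
    two are polynomial multiples of it.\<close>
  define G where "G = Gamma (\<alpha> - 1)"
  have G1: "Gamma \<alpha> = (\<alpha> - 1) * G"
    using Gamma_plus1[of "\<alpha> - 1"] pos_not_nonpos_Int[of "\<alpha> - 1"] assms by (simp add: G_def)
  have G2: "Gamma (\<alpha> + 1) = \<alpha> * ((\<alpha> - 1) * G)"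
    using Gamma_plus1[of \<alpha>] pos_not_nonpos_Int[of \<alpha>] assms by (simp add: G1)
  have L0: "L \<alpha> \<theta> = \<alpha> * ((\<alpha> - 1) * G) * J c (\<alpha> + 1)"
    using L_eq_Gamma_J[of \<alpha> \<theta>] assms c by (simp add: G2 c_def)
  have L1: "L (\<alpha> - 1) \<theta> = (\<alpha> - 1) * G * J c \<alpha>"
    using L_eq_Gamma_J[of "\<alpha> - 1" \<theta>] assms c by (simp add: G1 c_def)
  have L2: "L (\<alpha> - 2) \<theta> = G * J c (\<alpha> - 1)"
    using L_eq_Gamma_J[of "\<alpha> - 2" \<theta>] assms c by (simp add: G_def c_def)
  \<comment> \<open>The claim is \<open>J_recurrence\<close> multiplied by
    \<open>(\<alpha> - 1) * G\<close>; this factor accounts for the square on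
    \<open>\<alpha> - 1\<close>.\<close>
  have "(sin \<theta>)\<^sup>2 * L \<alpha> \<theta> = (\<alpha> - 1) * G * (\<alpha> * (1 - c\<^sup>2) * J c (\<alpha> + 1))"
    unfolding L0 by (simp add: sin_squared_eq c_def)
  also have "\<dots> = (2 * \<alpha> - 1) * c * L (\<alpha> - 1) \<theta> + (\<alpha> - 1)\<^sup>2 * L (\<alpha> - 2) \<theta>"
    using c assms unfolding L1 L2
    by (subst J_recurrence) (simp_all add: c_def algebra_simps power2_eq_square)
  finally show ?thesis
    using s unfolding c_def by (simp add: field_simps)
qed

end
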